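(* Let $\mathcal{H}$ be a separable Hilbert space, let $g,h\in\mathcal{H}$, and let $A$ and $B$ be bounded linear operators on $\mathcal{H}$. Suppose that: (i) any $f\in\mathcal{H}$ is recovered from the samples $\{\langle A^n f,g\rangle\}_{n\ge 0}$ in a stable way; (ii) for each positive real number $k$, there exist constants $\lambda_1,\lambda_2\ge 0$ such that $\max\{\lambda_1,\lambda_2\}<\min\{1,2^{k-1}\}$ and, for all $l\in\mathbb{Z}^+$ and all scalars $a_0,\dots,a_l$, $$\Big\|\sum_{n=0}^{l}a_n(A^* )^n(g-h)\Big\|+\Big\|\sum_{n=0}^{l}a_n\big((A^* )^n-(B^* )^n\big)h\Big\|\le\left[\lambda_1\Big\|\sum_{n=0}^{l}a_n(A^* )^n g\Big\|^k+\lambda_2\Big\|\sum_{n=0}^{l}a_n(B^* )^n h\Big\|^k\right]^{1/k}.$$ Then any $f\in\mathcal{H}$ can also be recovered from the samples $\{\langle B^n f,h\rangle\}_{n\ge 0}$ in a stable way.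
   Context: $\mathbb{Z}^+=\{0,1,2,\dots\}$, and $A^*,B^*$ denote the Hilbert-space adjoints of $A,B$. For a bounded linear operator $C$ on $\mathcal{H}$ and a vector $u\in\mathcal{H}$, "any $f\in\mathcal{H}$ is (can be) recovered from the samples $\{\langle C^n f,u\rangle\}_{n\ge 0}$ in a stable way" means: for every $f\in\mathcal{H}$ the sequence $\{\langle C^n f,u\rangle\}_{n\ge0}$ belongs to $\ell^2(\mathbb{Z}^+)$, and there exists a bounded linear operator $\mathscr{R}:\ell^2(\mathbb{Z}^+)\to\mathcal{H}$ such that $\mathscr{R}(\{\langle C^n f,u\rangle\}_{n\ge0})=f$ for all $f\in\mathcal{H}$. *)

theory Defs
  imports "HOL-Analysis.Analysis"
begin

text \<open>
  The scalar field of a Hilbert space. By the theorem of Gelfand and Mazur a real normed field is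
  the field of the real or of the complex numbers, and the last axiom below forces
  \<open>conjugate\<close> to be the identity or the complex conjugation, respectively; so the class treats
  real and complex Hilbert spaces simultaneously.
\<close>

class real_or_complex_field = real_normed_field + banach +
  fixes conjugate :: "'a \<Rightarrow> 'a"
  assumes conjugate_add: "conjugate (x + y) = conjugate x + conjugate y"
    and conjugate_mult: "conjugate (x * y) = conjugate x * conjugate y"
    and mult_conjugate: "x * conjugate x = (norm x)\<^sup>2 *\<^sub>R 1"

instantiation real :: real_or_complex_field
begin
definition conjugate_real_def: "conjugate x = x" for x :: real
instance
  by standard (auto simp: conjugate_real_def power2_eq_square)
end

instantiation complex :: real_or_complex_field
begin
definition conjugate_complex_def: "conjugate z = cnj z" for z :: complex
instance
  by standard (auto simp: conjugate_complex_def complex_norm_square[symmetric] scaleR_conv_of_real)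
end

text \<open>
  Completeness is part of the type class \<open>banach\<close>; the norm of that class is required to be the
  one induced by the inner product \<open>ip\<close>, which is linear in its first argument.
\<close>

locale hilbert_space = vector_space smul
  for smul :: "'s::real_or_complex_field \<Rightarrow> 'a::banach \<Rightarrow> 'a" +
  fixes ip :: "'a \<Rightarrow> 'a \<Rightarrow> 's"
  assumes scale_of_real: "smul (of_real r) x = r *\<^sub>R x"
    and ip_add_left: "ip (x + y) z = ip x z + ip y z"
    and ip_scale_left: "ip (smul c x) y = c * ip x y"
    and ip_commute: "ip y x = conjugate (ip x y)"
    and ip_self: "ip x x = of_real ((norm x)\<^sup>2)"

lemma hilbert_space_real: "hilbert_space scaleR (inner :: 'a::{real_inner,banach} \<Rightarrow> 'a \<Rightarrow> real)"
  by unfold_locales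
    (auto simp: conjugate_real_def inner_commute power2_norm_eq_inner algebra_simps)

lemma hilbert_space_complex: "hilbert_space (*) (\<lambda>z w :: complex. z * cnj w)"
  by unfold_locales
    (auto simp: conjugate_complex_def complex_norm_square[symmetric] scaleR_conv_of_real
      algebra_simps)

definition bounded_operator :: "('s::field \<Rightarrow> 'a::real_normed_vector \<Rightarrow> 'a) \<Rightarrow> ('a \<Rightarrow> 'a) \<Rightarrow> bool"
  where "bounded_operator smul A \<longleftrightarrow>
    Vector_Spaces.linear smul smul A \<and> (\<exists>K. \<forall>x. norm (A x) \<le> K * norm x)"

text \<open>
  For a bounded operator on a Hilbert space exactly one function satisfies the condition below:
  existence is the Riesz representation theorem.
\<close>

definition hilbert_adjoint :: "('a \<Rightarrow> 'a \<Rightarrow> 's) \<Rightarrow> ('a \<Rightarrow> 'a) \<Rightarrow> 'a \<Rightarrow> 'a"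
  where "hilbert_adjoint ip A = (THE A'. \<forall>x y. ip (A x) y = ip x (A' y))"

definition ell2 :: "(nat \<Rightarrow> 's::real_normed_vector) set"
  where "ell2 = {c. summable (\<lambda>n. (norm (c n))\<^sup>2)}"

definition ell2_norm :: "(nat \<Rightarrow> 's::real_normed_vector) \<Rightarrow> real"
  where "ell2_norm c = sqrt (\<Sum>n. (norm (c n))\<^sup>2)"

text \<open>
  Bounded linear operators from \<open>ell2\<close>: functions on all sequences, of which only the values on
  \<open>ell2\<close> matter.
\<close>

definition bounded_operator_ell2 ::
    "('s::real_normed_field \<Rightarrow> 'a::real_normed_vector \<Rightarrow> 'a) \<Rightarrow> ((nat \<Rightarrow> 's) \<Rightarrow> 'a) \<Rightarrow> bool"
  where "bounded_operator_ell2 smul R \<longleftrightarrow>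
    (\<forall>c\<in>ell2. \<forall>d\<in>ell2. R (\<lambda>n. c n + d n) = R c + R d) \<and>
    (\<forall>a. \<forall>c\<in>ell2. R (\<lambda>n. a * c n) = smul a (R c)) \<and>
    (\<exists>K. \<forall>c\<in>ell2. norm (R c) \<le> K * ell2_norm c)"

definition stably_recoverable ::
    "('s::real_normed_field \<Rightarrow> 'a::real_normed_vector \<Rightarrow> 'a) \<Rightarrow> ('a \<Rightarrow> 'a \<Rightarrow> 's) \<Rightarrow>
      ('a \<Rightarrow> 'a) \<Rightarrow> 'a \<Rightarrow> bool"
  where "stably_recoverable smul ip C u \<longleftrightarrow>
    (\<forall>f. (\<lambda>n. ip ((C ^^ n) f) u) \<in> ell2) \<and>
    (\<exists>R. bounded_operator_ell2 smul R \<and> (\<forall>f. R (\<lambda>n. ip ((C ^^ n) f) u) = f))"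

end

theory Submission imports Defs begin

text \<open>
  Write \<open>x\<^sub>n = (A\<^sup>*)\<^sup>n g\<close> and \<open>y\<^sub>n = (B\<^sup>*)\<^sup>n h\<close>. Since the samples are the coefficients
  \<open>\<langle>f, x\<^sub>n\<rangle>\<close>, stable recovery says that \<open>(x\<^sub>n)\<close> is a frame. Only the exponent \<open>k = 2\<close> of the
  hypothesis matters: with \<open>v = \<Sum> a\<^sub>n x\<^sub>n\<close> and \<open>w = \<Sum> a\<^sub>n y\<^sub>n\<close> it gives
  \<open>\<parallel>v - w\<parallel>\<^sup>2 \<le> \<mu> (\<parallel>v\<parallel>\<^sup>2 + \<parallel>w\<parallel>\<^sup>2)\<close> for some \<open>\<mu> < 1\<close>. Hence \<open>\<parallel>w\<parallel>\<close> is at most a multiple of \<open>\<parallel>v\<parallel>\<close>,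
  which is the upper frame bound for \<open>(y\<^sub>n)\<close>, and \<open>2 Re \<langle>v, w\<rangle> \<ge> (1 - \<mu>) \<parallel>v\<parallel>\<^sup>2\<close>. Applying the latter to
  an expansion \<open>f = \<Sum> a\<^sub>n x\<^sub>n\<close> with \<open>\<parallel>a\<parallel>\<close> at most a multiple of \<open>\<parallel>f\<parallel>\<close>, and
  \<open>\<langle>f, w\<rangle> = \<Sum> conjugate a\<^sub>n \<langle>f, y\<^sub>n\<rangle>\<close>, gives the lower one. Adjoints, expansions and the left
  inverse of the analysis operator all come from the Riesz representation theorem, for the inner
  product itself and for the equivalent one \<open>\<Sum> \<langle>f, x\<^sub>n\<rangle> conjugate \<langle>g, x\<^sub>n\<rangle>\<close>.
\<close>

subsection \<open>Conjugation\<close>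

lemma conjugate_zero [simp]: "conjugate (0::'s::real_or_complex_field) = 0"
  using conjugate_add[of "0::'s" 0] by simp

lemma mult_conjugate_of_real: "x * conjugate x = of_real ((norm x)\<^sup>2)"
  for x :: "'s::real_or_complex_field"
  by (simp add: mult_conjugate of_real_def)

lemma norm_conjugate [simp]: "norm (conjugate x) = norm x" for x :: "'s::real_or_complex_field"
proof (cases "x = 0")
  case False
  have "norm x * norm (conjugate x) = norm x * norm x"
    by (metis mult_conjugate_of_real norm_mult norm_of_real abs_power2 power2_eq_square)
  with False show ?thesis by simp
qed simp

lemma conjugate_conjugate [simp]: "conjugate (conjugate x) = x" for x :: "'s::real_or_complex_field"
proof (cases "x = 0")
  case False
  have "conjugate x * conjugate (conjugate x) = conjugate x * x"
    by (metis mult_conjugate_of_real norm_conjugate mult.commute)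
  moreover have "conjugate x \<noteq> 0" using False by (metis norm_conjugate norm_eq_zero)
  ultimately show ?thesis by simp
qed simp

text \<open>The axioms do not mention real scalars directly: \<open>mult_conjugate\<close> makes the
  product of \<open>of_real r\<close> with its conjugate the square of \<open>of_real r\<close>, and
  a nonzero factor cancels.\<close>

lemma conjugate_of_real [simp]: "conjugate (of_real r) = (of_real r :: 's::real_or_complex_field)"
proof (cases "r = 0")
  case False
  have "of_real r * conjugate (of_real r) = (of_real r * of_real r :: 's)"
    by (simp add: mult_conjugate_of_real power2_eq_square flip: of_real_mult)
  with False show ?thesis by simp
qed simp

text \<open>Allows conjugation to pass through infinite sums in
  \<open>ell2_inner_commute\<close>.\<close>

lemma bounded_linear_conjugate: "bounded_linear (conjugate :: 's \<Rightarrow> 's::real_or_complex_field)"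
proof (rule bounded_linear_intro[of _ 1])
  show "conjugate (r *\<^sub>R x) = r *\<^sub>R conjugate x" for r and x :: 's
    by (simp add: scaleR_conv_of_real conjugate_mult)
qed (auto simp: conjugate_add)

subsection \<open>Hermitian forms\<close>

text \<open>\<open>q\<close> is the diagonal of \<open>b\<close> read as a real number; it is a
  separate parameter because positivity and minimisation refer to the order of the reals, while
  \<open>b\<close> takes values in \<open>'s\<close>.\<close>

locale hermitian_form = vector_space smul
  for smul :: "'s::real_or_complex_field \<Rightarrow> 'a::ab_group_add \<Rightarrow> 'a" +
  fixes b :: "'a \<Rightarrow> 'a \<Rightarrow> 's" and q :: "'a \<Rightarrow> real"
  assumes add_left: "b (x + y) z = b x z + b y z"
    and scale_left: "b (smul c x) y = c * b x y"
    and commute: "b y x = conjugate (b x y)"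
    and self: "b x x = of_real (q x)"
    and nonneg: "0 \<le> q x"
begin

lemma add_right: "b x (y + z) = b x y + b x z"
  by (metis add_left commute conjugate_add)

lemma scale_right: "b x (smul c y) = conjugate c * b x y"
  by (metis scale_left commute conjugate_mult)

lemma zero_left [simp]: "b 0 x = 0"
  using add_left[of 0 0 x] by simp

lemma zero_right [simp]: "b x 0 = 0"
  using add_right[of x 0 0] by simp

lemma minus_left: "b (- x) y = - b x y"
  using add_left[of x "- x" y] by (simp add: eq_neg_iff_add_eq_0 add.commute)

lemma minus_right: "b x (- y) = - b x y"
  using add_right[of x y "- y"] by (simp add: eq_neg_iff_add_eq_0 add.commute)

lemma diff_left: "b (x - y) z = b x z - b y z"
  using add_left[of x "- y" z] by (simp add: minus_left)

lemma diff_right: "b x (y - z) = b x y - b x z"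
  using add_right[of x y "- z"] by (simp add: minus_right)

lemma sum_left: "b (\<Sum>i\<in>S. f i) y = (\<Sum>i\<in>S. b (f i) y)"
  by (induction S rule: infinite_finite_induct) (auto simp: add_left)

lemma sum_right: "b x (\<Sum>i\<in>S. f i) = (\<Sum>i\<in>S. b x (f i))"
  by (induction S rule: infinite_finite_induct) (auto simp: add_right)

lemma norm_commute: "norm (b x y) = norm (b y x)"
  by (metis commute norm_conjugate)

lemma scale_self: "q (smul c x) = (norm c)\<^sup>2 * q x"
proof -
  have "of_real (q (smul c x)) = (c * conjugate c) * b x x"
    by (simp flip: self add: scale_left scale_right)
  also have "\<dots> = (of_real ((norm c)\<^sup>2 * q x) :: 's)"
    by (simp add: mult_conjugate_of_real self)
  finally show ?thesis by (simp only: of_real_eq_iff)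
qed

lemma add_self: "of_real (q (x + y)) = of_real (q x) + of_real (q y) + (b x y + b y x)"
  by (simp flip: self add: add_left add_right)

lemma diff_self: "of_real (q (x - y)) = of_real (q x) + of_real (q y) - (b x y + b y x)"
  by (simp flip: self add: diff_left diff_right)

lemma parallelogram: "q (x + y) + q (x - y) = 2 * q x + 2 * q y"
proof -
  have "of_real (q (x + y) + q (x - y)) = (of_real (2 * q x + 2 * q y) :: 's)"
    by (simp add: add_self diff_self)
  then show ?thesis by (simp only: of_real_eq_iff)
qed

text \<open>Pythagoras for the projection of \<open>x\<close> onto the line through
  \<open>y\<close>. It yields both Cauchy-Schwarz and the orthogonality of a minimal point in the
  Riesz argument.\<close>

lemma self_diff_projection:
  assumes "q y \<noteq> 0"
  shows "q (x - smul (b x y / of_real (q y)) y) = q x - (norm (b x y))\<^sup>2 / q y"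
proof -
  define t where "t = b x y / of_real (q y)"
  have [simp]: "(of_real (q y) :: 's) \<noteq> 0" using assms by simp
  have yt: "q (smul t y) = (norm (b x y))\<^sup>2 / q y"
    using nonneg[of y] assms
    by (simp add: scale_self t_def norm_divide power_divide power2_eq_square)
  have c1: "conjugate t = b y x / of_real (q y)"
  proof -
    have "conjugate t * of_real (q y) = conjugate (t * of_real (q y))"
      by (simp add: conjugate_mult)
    also have "\<dots> = b y x" using assms by (simp add: t_def flip: commute)
    finally show ?thesis using assms by (simp add: field_simps)
  qed
  have n: "b x y * b y x = of_real ((norm (b x y))\<^sup>2)"
    by (metis commute mult_conjugate_of_real)
  have "of_real (q (x - smul t y)) = of_real (q x) + of_real (q (smul t y))
      - (conjugate t * b x y + t * b y x)"
    by (simp add: diff_self scale_left scale_right)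
  also have "conjugate t * b x y + t * b y x = of_real (2 * ((norm (b x y))\<^sup>2 / q y))"
    unfolding c1 unfolding t_def using n by (simp add: mult.commute)
  finally have "of_real (q (x - smul t y))
      = (of_real (q x + q (smul t y) - 2 * ((norm (b x y))\<^sup>2 / q y)) :: 's)"
    by simp
  then have "q (x - smul t y) = q x + q (smul t y) - 2 * ((norm (b x y))\<^sup>2 / q y)"
    by (simp only: of_real_eq_iff)
  with yt show ?thesis by (simp add: t_def)
qed

lemma Cauchy_Schwarz:
  assumes "q y = 0 \<Longrightarrow> y = 0"
  shows "norm (b x y) \<le> sqrt (q x) * sqrt (q y)"
proof (cases "q y = 0")
  case True
  then show ?thesis using assms by simp
next
  case False
  then have pos: "q y > 0" using nonneg[of y] by simp
  have "0 \<le> q x - (norm (b x y))\<^sup>2 / q y"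
    using self_diff_projection[OF False, of x] nonneg by metis
  with pos have "(norm (b x y))\<^sup>2 \<le> q x * q y" by (simp add: field_simps)
  then show ?thesis by (metis real_le_rsqrt real_sqrt_mult)
qed

end

section \<open>Forms equivalent to the squared norm, and Riesz representation for them\<close>

locale coercive_form = hermitian_form smul b q
  for smul :: "'s::real_or_complex_field \<Rightarrow> 'a::banach \<Rightarrow> 'a" and b q +
  fixes m M :: real
  assumes m_pos: "0 < m"
    and lower: "m * (norm x)\<^sup>2 \<le> q x"
    and upper: "q x \<le> M * (norm x)\<^sup>2"
begin

lemma self_eq_0D: "q x = 0 \<Longrightarrow> x = 0"
  using lower[of x] m_pos by (simp add: mult_le_0_iff)

lemma sqrt_triangle: "sqrt (q (x + y)) \<le> sqrt (q x) + sqrt (q y)"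
proof -
  have "q (x + y) = norm (of_real (q (x + y)) :: 's)" using nonneg by simp
  also have "\<dots> \<le> norm (of_real (q x) :: 's) + norm (of_real (q y) :: 's)
      + (norm (b x y) + norm (b y x))"
    unfolding add_self by (intro norm_triangle_le add_mono order_refl)
  also have "\<dots> \<le> q x + q y + 2 * (sqrt (q x) * sqrt (q y))"
    using nonneg Cauchy_Schwarz[OF self_eq_0D, of x y] by (simp add: norm_commute[of y x] mult.commute)
  also have "\<dots> = (sqrt (q x) + sqrt (q y))\<^sup>2"
    using nonneg by (simp add: power2_sum)
  finally show ?thesis using nonneg by (simp add: real_le_lsqrt)
qed

lemma representer_unique:
  assumes "\<And>x. b x r = b x s"
  shows "r = s"
proof -
  have "b (r - s) (r - s) = 0" using assms by (simp add: diff_right)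
  then show ?thesis using self_eq_0D[of "r - s"] by (simp add: self)
qed

text \<open>Riesz representation; the representer is a multiple of the point of the hyperplane
  \<open>\<phi> = 1\<close> where \<open>q\<close> is minimal.\<close>

lemma representer_exists:
  assumes phi_add: "\<And>x y. \<phi> (x + y) = \<phi> x + \<phi> y"
    and phi_scale: "\<And>c x. \<phi> (smul c x) = c * \<phi> x"
    and phi_bounded: "\<And>x. norm (\<phi> x) \<le> K * norm x"
  shows "\<exists>r. \<forall>x. \<phi> x = b x r"
proof (cases "\<forall>x. \<phi> x = 0")
  case True
  then show ?thesis by (intro exI[of _ 0]) simp
next
  case False
  have phi_diff: "\<phi> (x - y) = \<phi> x - \<phi> y" for x y
    using phi_add[of "x - y" y] by simp
  define H where "H = {x. \<phi> x = 1}"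
  define d where "d = Inf (q ` H)"
  from False obtain z where "\<phi> z \<noteq> 0" by blast
  then have "smul (inverse (\<phi> z)) z \<in> H" by (simp add: H_def phi_scale)
  then have ne: "q ` H \<noteq> {}" by blast
  have bdd: "bdd_below (q ` H)" using nonneg by (auto intro!: bdd_belowI[of _ 0])
  have d_le: "d \<le> q x" if "x \<in> H" for x
    unfolding d_def using that bdd by (intro cInf_lower) auto
  have "\<exists>x\<in>H. q x < d + inverse (Suc n)" for n
    using cInf_lessD[OF ne, of "d + inverse (Suc n)"] by (auto simp: d_def)
  then obtain X where X: "\<And>n. X n \<in> H" "\<And>n. q (X n) < d + inverse (Suc n)" by metis
  \<comment> \<open>The midpoint of two points of \<open>H\<close> lies in \<open>H\<close>, so
    \<open>q\<close> is at least \<open>d\<close> there; the parallelogram law then keeps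
    near-minimisers close, and coercivity transfers this to the norm.\<close>
  have dist_X: "m * (norm (X i - X j))\<^sup>2 \<le> 2 * inverse (Suc i) + 2 * inverse (Suc j)" for i j
  proof -
    let ?h = "inverse (of_real 2) :: 's"
    have "\<phi> (smul ?h (X i + X j)) = 1"
      using X(1)[of i] X(1)[of j] by (simp add: H_def phi_scale phi_add)
    then have "d \<le> q (smul ?h (X i + X j))" using d_le by (simp add: H_def)
    also have "\<dots> = q (X i + X j) / 4"
      by (simp add: scale_self norm_inverse power2_eq_square)
    finally have "4 * d \<le> q (X i + X j)" by simp
    with parallelogram[of "X i" "X j"] X(2)[of i] X(2)[of j] lower[of "X i - X j"]
    show ?thesis by linarith
  qed
  have "Cauchy X"
  proof (rule metric_CauchyI)
    fix e :: real assume "0 < e"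
    then obtain N where N: "inverse (Suc N) < m * e\<^sup>2 / 4"
      using m_pos reals_Archimedean[of "m * e\<^sup>2 / 4"] by auto
    have "dist (X i) (X j) < e" if "i \<ge> N" "j \<ge> N" for i j
    proof -
      have "inverse (real (Suc i)) \<le> inverse (Suc N)" "inverse (real (Suc j)) \<le> inverse (Suc N)"
        using that by (auto intro!: le_imp_inverse_le)
      then have "m * (norm (X i - X j))\<^sup>2 < m * e\<^sup>2" using dist_X[of i j] N by linarith
      then have "(norm (X i - X j))\<^sup>2 < e\<^sup>2" using m_pos by simp
      then show ?thesis using \<open>0 < e\<close> by (simp add: dist_norm power_less_imp_less_base)
    qed
    then show "\<exists>N. \<forall>i\<ge>N. \<forall>j\<ge>N. dist (X i) (X j) < e" by blast
  qed
  then obtain u where u: "X \<longlonglongrightarrow> u" using Cauchy_convergent convergent_def by blast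
  then have diff0: "(\<lambda>n. norm (u - X n)) \<longlonglongrightarrow> 0"
    using tendsto_norm_zero[of "\<lambda>n. u - X n"] tendsto_diff[OF tendsto_const u, of u] by simp
  have "(\<lambda>n. \<phi> u - \<phi> (X n)) \<longlonglongrightarrow> 0"
    by (rule tendsto_0_le[OF diff0, of _ K])
      (use phi_bounded in \<open>auto simp: mult.commute simp flip: phi_diff\<close>)
  then have "(\<lambda>n. \<phi> u - 1) \<longlonglongrightarrow> 0" using X(1) by (simp add: H_def)
  then have u1: "\<phi> u = 1" by (simp add: LIMSEQ_const_iff)
  \<comment> \<open>Semicontinuity of \<open>q\<close> at the limit: its square root obeys the
    triangle inequality, and \<open>q (u - X n)\<close> is controlled by the upper constant
    \<open>M\<close>.\<close>
  have "sqrt (q u) \<le> sqrt d"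
  proof (rule LIMSEQ_le_const)
    show "(\<lambda>n. sqrt (d + inverse (real (Suc n))) + sqrt M * norm (u - X n)) \<longlonglongrightarrow> sqrt d"
      using tendsto_add[OF tendsto_real_sqrt[OF tendsto_add[OF tendsto_const LIMSEQ_inverse_real_of_nat]]
        tendsto_mult[OF tendsto_const diff0], of d "sqrt M"] by simp
    have "sqrt (q u) \<le> sqrt (d + inverse (real (Suc n))) + sqrt M * norm (u - X n)" for n
    proof -
      have "sqrt (q (u - X n)) \<le> sqrt (M * (norm (u - X n))\<^sup>2)" using upper by simp
      moreover have "sqrt (q (X n)) \<le> sqrt (d + inverse (real (Suc n)))"
        using X(2)[of n] by (intro real_sqrt_le_mono less_imp_le)
      ultimately show ?thesis
        using sqrt_triangle[of "X n" "u - X n"] by (simp add: real_sqrt_mult del: real_sqrt_le_iff)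
    qed
    then show "\<exists>N. \<forall>n\<ge>N. sqrt (q u) \<le> sqrt (d + inverse (real (Suc n))) + sqrt M * norm (u - X n)"
      by blast
  qed
  then have min_u: "q u \<le> q x" if "\<phi> x = 1" for x
    using d_le[of x] that by (simp add: H_def)
  \<comment> \<open>Subtracting a multiple of \<open>v\<close> from \<open>u\<close> stays on the
    hyperplane, so by minimality removing the projection onto \<open>v\<close> cannot decrease
    \<open>q\<close>.\<close>
  have orth: "b v u = 0" if "\<phi> v = 0" for v
  proof (cases "q v = 0")
    case True
    then show ?thesis using self_eq_0D[OF True] by simp
  next
    case False
    have "q u \<le> q u - (norm (b u v))\<^sup>2 / q v"
      unfolding self_diff_projection[OF False, symmetric]
      by (rule min_u) (simp add: phi_diff phi_scale u1 that)
    then have "(norm (b u v))\<^sup>2 / q v \<le> 0" by simp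
    then have "b u v = 0" using False nonneg[of v] by (simp add: divide_le_0_iff)
    then show ?thesis using commute[where x = u and y = v] by simp
  qed
  have "u \<noteq> 0" using u1 phi_diff[of 0 0] by auto
  then have qu: "q u \<noteq> 0" using self_eq_0D by blast
  \<comment> \<open>\<open>x - smul (\<phi> x) u\<close> lies in the kernel of \<open>\<phi>\<close>
    and is thus orthogonal to \<open>u\<close>; this fixes the factor
    \<open>1 / q u\<close>.\<close>
  have "\<phi> x = b x (smul (of_real (inverse (q u))) u)" for x
  proof -
    have "b (x - smul (\<phi> x) u) u = 0" by (rule orth) (simp add: phi_diff phi_scale u1)
    then have "b x u = \<phi> x * of_real (q u)" by (simp add: diff_left scale_left self)
    then show ?thesis using qu by (simp only: scale_right conjugate_of_real) simp
  qed
  then show ?thesis by blast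
qed

end

subsection \<open>Square-summable sequences\<close>

lemma L2_set_norm_le_ell2_norm:
  assumes "c \<in> ell2" and "finite S"
  shows "L2_set (\<lambda>n. norm (c n)) S \<le> ell2_norm c"
  using assms unfolding L2_set_def ell2_norm_def ell2_def
  by (intro real_sqrt_le_mono sum_le_suminf) auto

text \<open>The finite Cauchy-Schwarz inequality bounds all partial sums by the same product of
  norms, which gives convergence and the estimate together.\<close>

lemma
  assumes c: "c \<in> ell2" and d: "d \<in> ell2"
  shows summable_norm_mult_ell2: "summable (\<lambda>n. norm (c n) * norm (d n))"
    and suminf_norm_mult_ell2: "(\<Sum>n. norm (c n) * norm (d n)) \<le> ell2_norm c * ell2_norm d"
proof -
  have bound: "(\<Sum>n\<in>S. norm (c n) * norm (d n)) \<le> ell2_norm c * ell2_norm d" if "finite S" for S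
  proof -
    have "(\<Sum>n\<in>S. norm (c n) * norm (d n))
        \<le> L2_set (\<lambda>n. norm (c n)) S * L2_set (\<lambda>n. norm (d n)) S"
      using L2_set_mult_ineq[of "\<lambda>n. norm (c n)" "\<lambda>n. norm (d n)" S] by simp
    also have "\<dots> \<le> ell2_norm c * ell2_norm d"
      using that c d by (intro mult_mono L2_set_norm_le_ell2_norm L2_set_nonneg)
        (auto simp: ell2_norm_def ell2_def intro!: suminf_nonneg)
    finally show ?thesis .
  qed
  show *: "summable (\<lambda>n. norm (c n) * norm (d n))"
    by (rule summableI_nonneg_bounded[of _ "ell2_norm c * ell2_norm d"]) (auto intro: bound)
  show "(\<Sum>n. norm (c n) * norm (d n)) \<le> ell2_norm c * ell2_norm d"
    by (rule suminf_le_const[OF *]) (auto intro: bound)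
qed

lemma ell2_norm_nonneg [simp]: "c \<in> ell2 \<Longrightarrow> 0 \<le> ell2_norm c"
  by (auto simp: ell2_norm_def ell2_def intro!: suminf_nonneg)

lemma ell2_norm_square: "c \<in> ell2 \<Longrightarrow> (ell2_norm c)\<^sup>2 = (\<Sum>n. (norm (c n))\<^sup>2)"
  by (auto simp: ell2_norm_def ell2_def intro!: suminf_nonneg)

definition ell2_inner :: "(nat \<Rightarrow> 's) \<Rightarrow> (nat \<Rightarrow> 's) \<Rightarrow> 's::real_or_complex_field"
  where "ell2_inner c d = (\<Sum>n. c n * conjugate (d n))"

lemma summable_ell2_inner:
  assumes "c \<in> ell2" "d \<in> ell2"
  shows "summable (\<lambda>n. c n * conjugate (d n :: 's::real_or_complex_field))"
  by (rule summable_norm_cancel) (use summable_norm_mult_ell2[OF assms] in \<open>simp add: norm_mult\<close>)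

lemma norm_ell2_inner_le:
  assumes "c \<in> ell2" "d \<in> ell2"
  shows "norm (ell2_inner c d) \<le> ell2_norm c * ell2_norm d"
  using summable_norm[of "\<lambda>n. c n * conjugate (d n)"]
    summable_norm_mult_ell2[OF assms] suminf_norm_mult_ell2[OF assms]
  by (simp add: norm_mult ell2_inner_def)

lemma ell2_inner_add_left:
  assumes "c \<in> ell2" "d \<in> ell2" "e \<in> ell2"
  shows "ell2_inner (\<lambda>n. c n + d n) e = ell2_inner c e + ell2_inner d e"
  unfolding ell2_inner_def
  using suminf_add[OF summable_ell2_inner[OF assms(1,3)] summable_ell2_inner[OF assms(2,3)]]
  by (simp add: ring_distribs)

lemma ell2_inner_add_right:
  assumes "c \<in> ell2" "d \<in> ell2" "e \<in> ell2"
  shows "ell2_inner e (\<lambda>n. c n + d n) = ell2_inner e c + ell2_inner e d"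
  unfolding ell2_inner_def
  using suminf_add[OF summable_ell2_inner[OF assms(3,1)] summable_ell2_inner[OF assms(3,2)]]
  by (simp add: ring_distribs conjugate_add)

lemma ell2_inner_scale_left:
  assumes "c \<in> ell2" "d \<in> ell2"
  shows "ell2_inner (\<lambda>n. a * c n) d = a * ell2_inner c d"
  unfolding ell2_inner_def
  using suminf_mult[OF summable_ell2_inner[OF assms], of a] by (simp add: mult.assoc)

lemma ell2_inner_scale_right:
  assumes "c \<in> ell2" "d \<in> ell2"
  shows "ell2_inner c (\<lambda>n. a * d n) = conjugate a * ell2_inner c d"
  unfolding ell2_inner_def
  using suminf_mult[OF summable_ell2_inner[OF assms], of "conjugate a"]
  by (simp add: conjugate_mult mult_ac)

lemma ell2_inner_commute:
  assumes "c \<in> ell2" "d \<in> ell2"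
  shows "ell2_inner d c = conjugate (ell2_inner c d)"
  unfolding ell2_inner_def
  using bounded_linear.suminf[OF bounded_linear_conjugate summable_ell2_inner[OF assms]]
  by (simp add: conjugate_mult mult.commute)

lemma ell2_inner_self:
  assumes "c \<in> ell2"
  shows "ell2_inner c c = of_real ((ell2_norm c)\<^sup>2)"
  unfolding ell2_inner_def ell2_norm_square[OF assms] mult_conjugate_of_real
  by (rule suminf_of_real[symmetric]) (use assms in \<open>simp add: ell2_def\<close>)

lemma ell2_add:
  assumes "c \<in> ell2" "d \<in> ell2"
  shows "(\<lambda>n. c n + d n) \<in> ell2"
proof -
  have "summable (\<lambda>n. 2 * (norm (c n))\<^sup>2 + 2 * (norm (d n))\<^sup>2)"
    using assms unfolding ell2_def by (intro summable_add summable_mult) auto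
  moreover have "(norm (c n + d n))\<^sup>2 \<le> 2 * (norm (c n))\<^sup>2 + 2 * (norm (d n))\<^sup>2" for n
    using power_mono[OF norm_triangle_ineq[of "c n" "d n"], of 2]
      sum_squares_bound[of "norm (c n)" "norm (d n)"]
    by (simp add: power2_sum)
  ultimately have "summable (\<lambda>n. (norm (c n + d n))\<^sup>2)"
    by - (erule summable_comparison_test'[where N = 0], simp)
  then show ?thesis by (simp add: ell2_def)
qed

lemma ell2_scale: "c \<in> ell2 \<Longrightarrow> (\<lambda>n. a * c n :: 's::real_normed_field) \<in> ell2"
  by (simp add: ell2_def norm_mult power_mult_distrib summable_mult)

subsection \<open>Adjoints\<close>

text \<open>The inner product is coercive with both constants 1, so Riesz representation applies to
  it.\<close>

sublocale hilbert_space \<subseteq> ip: coercive_form smul ip "\<lambda>x. (norm x)\<^sup>2" 1 1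
  by unfold_locales (auto simp: ip_add_left ip_scale_left ip_self simp flip: ip_commute)

context hilbert_space
begin

lemma norm_ip_le: "norm (ip x y) \<le> norm x * norm y"
  using ip.Cauchy_Schwarz[of y x] by simp

lemma ip_nondegenerate: "(\<And>x. ip x y = ip x z) \<Longrightarrow> y = z"
  by (rule ip.representer_unique)

lemma bounded_linear_ip: "bounded_linear (\<lambda>x. ip x y)"
proof (rule bounded_linear_intro[of _ "norm y"])
  show "ip (r *\<^sub>R x) y = r *\<^sub>R ip x y" for r x
    by (metis ip_scale_left scale_of_real scaleR_conv_of_real)
qed (auto simp: ip_add_left norm_ip_le)

text \<open>Riesz representation of \<open>ip (A x) y\<close> as a functional of \<open>x\<close>
  gives an adjoint pointwise; nondegeneracy gives the uniqueness that the definite description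
  requires.\<close>

lemma bounded_operator_adjoint:
  assumes "bounded_operator smul A"
  shows "ip (A x) y = ip x (hilbert_adjoint ip A y)"
proof -
  from assms obtain K where A: "Vector_Spaces.linear smul smul A" "\<And>x. norm (A x) \<le> K * norm x"
    by (auto simp: bounded_operator_def)
  interpret A: Vector_Spaces.linear smul smul A by fact
  have "\<exists>r. \<forall>x. ip (A x) y = ip x r" for y
  proof (rule ip.representer_exists)
    show "norm (ip (A x) y) \<le> (K * norm y) * norm x" for x
      using norm_ip_le[of "A x" y] mult_right_mono[OF A(2)[of x] norm_ge_zero[of y]]
      by (simp add: mult_ac)
  qed (auto simp: A.add A.scale ip_add_left ip_scale_left)
  then obtain A' where A': "\<And>x y. ip (A x) y = ip x (A' y)" by metis
  have "\<forall>x y. ip (A x) y = ip x (hilbert_adjoint ip A y)"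
    unfolding hilbert_adjoint_def
  proof (rule theI[of _ A'])
    fix A'' assume "\<forall>x y. ip (A x) y = ip x (A'' y)"
    then show "A'' = A'" by (intro ext ip_nondegenerate) (metis A')
  qed (simp add: A')
  then show ?thesis by blast
qed

text \<open>Turns samples along an orbit of \<open>x\<close> into inner products of \<open>x\<close>
  with a fixed sequence of vectors.\<close>

lemma bounded_operator_adjoint_funpow:
  assumes "bounded_operator smul A"
  shows "ip ((A ^^ n) x) y = ip x ((hilbert_adjoint ip A ^^ n) y)"
proof (induction n arbitrary: x)
  case (Suc n)
  have "ip ((A ^^ Suc n) x) y = ip ((A ^^ n) (A x)) y" by (simp add: funpow_swap1)
  also have "\<dots> = ip x ((hilbert_adjoint ip A ^^ Suc n) y)"
    by (simp add: Suc.IH bounded_operator_adjoint[OF assms])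
  finally show ?case .
qed simp

text \<open>Pairing with every vector moves the iterates back to \<open>A\<close>, where only
  additivity of \<open>ip\<close> is involved. Serves to split the terms with \<open>g - h\<close>
  in the hypothesis.\<close>

lemma adjoint_funpow_diff:
  assumes "bounded_operator smul A"
  shows "(hilbert_adjoint ip A ^^ n) (y - z)
    = (hilbert_adjoint ip A ^^ n) y - (hilbert_adjoint ip A ^^ n) z"
proof (rule ip_nondegenerate)
  fix x
  note adj = bounded_operator_adjoint_funpow[OF assms, symmetric]
  show "ip x ((hilbert_adjoint ip A ^^ n) (y - z))
      = ip x ((hilbert_adjoint ip A ^^ n) y - (hilbert_adjoint ip A ^^ n) z)"
    unfolding adj ip.diff_right ..
qed

end

subsection \<open>Frames\<close>

context hilbert_space
begin

abbreviation analysis :: "(nat \<Rightarrow> 'a) \<Rightarrow> 'a \<Rightarrow> nat \<Rightarrow> 's"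
  where "analysis x f \<equiv> \<lambda>n. ip f (x n)"

text \<open>The space is the union of the closed sets on which the
  square sums are bounded by \<open>m\<close>, so by Baire's theorem one of them contains a ball.\<close>

lemma analysis_bounded:
  assumes x: "\<And>f. analysis x f \<in> ell2"
  obtains M where "0 \<le> M" "\<And>f. (ell2_norm (analysis x f))\<^sup>2 \<le> M * (norm f)\<^sup>2"
proof -
  define F where "F m = (\<Inter>N. {f. (\<Sum>n<N. (norm (ip f (x n)))\<^sup>2) \<le> real m})" for m :: nat
  have closed_F: "closed (F m)" for m
    unfolding F_def
    by (intro closed_INT ballI closed_Collect_le continuous_on_const continuous_on_sum
        continuous_on_power continuous_on_norm linear_continuous_on[OF bounded_linear_ip])
  have "f \<in> \<Union>(range F)" for f
  proof -
    obtain m :: nat where m: "(\<Sum>n. (norm (ip f (x n)))\<^sup>2) \<le> m" using real_arch_simple by blast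
    have "(\<Sum>n<N. (norm (ip f (x n)))\<^sup>2) \<le> m" for N
      using x[of f] by (intro order.trans[OF sum_le_suminf m]) (auto simp: ell2_def)
    then show ?thesis by (auto simp: F_def)
  qed
  then have cover: "\<Union>(range F) = UNIV" by blast
  have "\<exists>m. interior (F m) \<noteq> {}"
  proof (rule ccontr)
    assume empty: "\<not> ?thesis"
    have "Met_TC.mtopology interior_of \<Union>(range F) = {}"
    proof (rule Met_TC.metric_Baire_category_alt)
      show "Met_TC.mcomplete TYPE('a)"
        using complete_UNIV by simp
    qed (use empty closed_F in auto)
    then show False using cover by simp
  qed
  then obtain m f0 where "f0 \<in> interior (F m)" by blast
  then obtain e where e: "e > 0" "ball f0 e \<subseteq> F m" using mem_interior by blast
  \<comment> \<open>Write \<open>w\<close> as \<open>(f0 + w) - f0\<close> with both points in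
    \<open>F m\<close>; squaring the triangle inequality costs a factor 2 on each, hence 4 in
    total.\<close>
  have small: "(\<Sum>n<N. (norm (ip w (x n)))\<^sup>2) \<le> 4 * real m" if "norm w < e" for w N
  proof -
    have F: "f0 + w \<in> F m" "f0 \<in> F m" using that e by (auto simp: dist_norm)
    have "(norm (ip w (x n)))\<^sup>2
        \<le> 2 * (norm (ip (f0 + w) (x n)))\<^sup>2 + 2 * (norm (ip f0 (x n)))\<^sup>2" for n
    proof -
      have "norm (ip w (x n)) \<le> norm (ip (f0 + w) (x n)) + norm (ip f0 (x n))"
        using norm_triangle_ineq4[of "ip (f0 + w) (x n)" "ip f0 (x n)"]
        by (simp add: ip_add_left)
      from power_mono[OF this, of 2]
        sum_squares_bound[of "norm (ip (f0 + w) (x n))" "norm (ip f0 (x n))"]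
      show ?thesis by (simp add: power2_sum)
    qed
    then have "(\<Sum>n<N. (norm (ip w (x n)))\<^sup>2)
        \<le> (\<Sum>n<N. 2 * (norm (ip (f0 + w) (x n)))\<^sup>2 + 2 * (norm (ip f0 (x n)))\<^sup>2)"
      by (rule sum_mono)
    also have "\<dots> = 2 * (\<Sum>n<N. (norm (ip (f0 + w) (x n)))\<^sup>2)
        + 2 * (\<Sum>n<N. (norm (ip f0 (x n)))\<^sup>2)"
      by (simp add: sum.distrib sum_distrib_left)
    also have "\<dots> \<le> 2 * real m + 2 * real m"
      using F unfolding F_def by (intro add_mono mult_left_mono) auto
    finally show ?thesis by simp
  qed
  have "(ell2_norm (analysis x f))\<^sup>2 \<le> (16 * real m / e\<^sup>2) * (norm f)\<^sup>2" for f
  proof (cases "f = 0")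
    case True
    then show ?thesis by (simp add: ell2_norm_def)
  next
    case False
    \<comment> \<open>Rescales \<open>f\<close> to norm \<open>e / 2\<close>; the later constant 16
      is the 4 of \<open>small\<close> times the square of this 2.\<close>
    define t where "t = e / (2 * norm f)"
    have t: "t > 0" "norm (smul (of_real t) f) < e"
      using False e(1) by (auto simp: t_def scale_of_real simp del: of_real_divide)
    have "(\<Sum>n<N. (norm (ip f (x n)))\<^sup>2) \<le> 4 * real m / t\<^sup>2" for N
    proof -
      have "(\<Sum>n<N. (norm (ip (smul (of_real t) f) (x n)))\<^sup>2)
          = t\<^sup>2 * (\<Sum>n<N. (norm (ip f (x n)))\<^sup>2)"
        by (simp add: ip_scale_left norm_mult power_mult_distrib sum_distrib_left)
      then show ?thesis using small[OF t(2), of N] t(1) by (simp add: pos_le_divide_eq mult.commute)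
    qed
    then have "(\<Sum>n. (norm (ip f (x n)))\<^sup>2) \<le> 4 * real m / t\<^sup>2"
      using x[of f] by (intro suminf_le_const) (auto simp: ell2_def)
    also have "\<dots> = (16 * real m / e\<^sup>2) * (norm f)\<^sup>2"
      using False e(1) by (simp add: t_def power_divide power_mult_distrib)
    finally show ?thesis using x by (simp add: ell2_norm_square)
  qed
  then show thesis by (rule that[rotated]) simp
qed

end

section \<open>Frames with explicit bounds, and the left inverse of the analysis operator\<close>

locale frame = hilbert_space smul ip
  for smul :: "'s::real_or_complex_field \<Rightarrow> 'a::banach \<Rightarrow> 'a" and ip +
  fixes x :: "nat \<Rightarrow> 'a" and m M :: real
  assumes analysis_in_ell2: "analysis x f \<in> ell2"
    and m_pos: "0 < m"
    and M_nonneg: "0 \<le> M"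
    and lower: "m * (norm f)\<^sup>2 \<le> (ell2_norm (analysis x f))\<^sup>2"
    and upper: "(ell2_norm (analysis x f))\<^sup>2 \<le> M * (norm f)\<^sup>2"

text \<open>This form is \<open>ip (S f) g\<close> for the frame operator \<open>S\<close>, and the
  frame bounds are its coercivity constants. Its Riesz representation thus amounts to inverting
  \<open>S\<close>.\<close>

sublocale frame \<subseteq> form: coercive_form smul
    "\<lambda>f g. ell2_inner (analysis x f) (analysis x g)" "\<lambda>f. (ell2_norm (analysis x f))\<^sup>2" m M
proof unfold_locales
  fix f g h :: 'a and c :: 's
  show "ell2_inner (analysis x (f + g)) (analysis x h)
      = ell2_inner (analysis x f) (analysis x h) + ell2_inner (analysis x g) (analysis x h)"
    unfolding ip_add_left by (intro ell2_inner_add_left analysis_in_ell2)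
  show "ell2_inner (analysis x (smul c f)) (analysis x g)
      = c * ell2_inner (analysis x f) (analysis x g)"
    unfolding ip_scale_left by (intro ell2_inner_scale_left analysis_in_ell2)
  show "ell2_inner (analysis x g) (analysis x f)
      = conjugate (ell2_inner (analysis x f) (analysis x g))"
    by (intro ell2_inner_commute analysis_in_ell2)
  show "ell2_inner (analysis x f) (analysis x f) = of_real ((ell2_norm (analysis x f))\<^sup>2)"
    by (intro ell2_inner_self analysis_in_ell2)
qed (auto intro: m_pos lower upper)

context frame
begin

lemma upper_sqrt: "ell2_norm (analysis x f) \<le> sqrt M * norm f"
  using real_sqrt_le_mono[OF upper[of f]] analysis_in_ell2[of f]
  by (simp add: real_sqrt_mult del: real_sqrt_le_iff)

text \<open>Synthesis is adjoint to analysis and inherits its bound: pair the sum \<open>s\<close>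
  with itself, apply Cauchy-Schwarz to the coefficients and cancel one factor
  \<open>norm s\<close>.\<close>

lemma norm_synthesis_le:
  assumes "finite S"
  shows "norm (\<Sum>n\<in>S. smul (c n) (x n)) \<le> sqrt M * L2_set (\<lambda>n. norm (c n)) S"
proof -
  define s where "s = (\<Sum>n\<in>S. smul (c n) (x n))"
  have "(norm s)\<^sup>2 = norm (ip s s)" by (simp add: ip_self norm_power)
  also have "ip s s = (\<Sum>n\<in>S. c n * ip (x n) s)"
    by (subst (1) s_def) (simp add: ip.sum_left ip_scale_left)
  also have "norm \<dots> \<le> (\<Sum>n\<in>S. norm (c n) * norm (ip s (x n)))"
    by (rule order.trans[OF norm_sum]) (simp add: norm_mult ip.norm_commute[of s])
  also have "\<dots> \<le> L2_set (\<lambda>n. norm (c n)) S * L2_set (\<lambda>n. norm (ip s (x n))) S"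
    using L2_set_mult_ineq[of "\<lambda>n. norm (c n)" "\<lambda>n. norm (ip s (x n))" S] by simp
  also have "\<dots> \<le> L2_set (\<lambda>n. norm (c n)) S * (sqrt M * norm s)"
    using L2_set_norm_le_ell2_norm[OF analysis_in_ell2 assms] upper_sqrt
    by (intro mult_left_mono L2_set_nonneg) (meson order.trans)
  finally have "norm s * norm s \<le> (sqrt M * L2_set (\<lambda>n. norm (c n)) S) * norm s"
    by (simp add: power2_eq_square mult_ac)
  moreover have "0 \<le> sqrt M * L2_set (\<lambda>n. norm (c n)) S"
    using M_nonneg by (simp add: L2_set_nonneg)
  ultimately show ?thesis
    by (cases "norm s = 0") (auto simp: s_def)
qed


lemma ell2_inner_analysis_bounded:
  assumes "c \<in> ell2"
  shows "norm (ell2_inner (analysis x f) c) \<le> (sqrt M * ell2_norm c) * norm f"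
  using norm_ell2_inner_le[OF analysis_in_ell2[of f] assms]
    mult_right_mono[OF upper_sqrt[of f] ell2_norm_nonneg[OF assms]]
  by (simp add: mult_ac)

text \<open>\<open>R c\<close> represents the functional \<open>ell2_inner (analysis x f) c\<close>
  of \<open>f\<close> in the frame form, so it is the inverse frame operator applied to the
  synthesis of \<open>c\<close>. Linearity and the left inverse property follow from uniqueness of
  representers.\<close>

lemma bounded_left_inverse:
  "\<exists>R. bounded_operator_ell2 smul R \<and> (\<forall>f. R (analysis x f) = f)"
proof -
  have "\<exists>r. \<forall>f. ell2_inner (analysis x f) c = ell2_inner (analysis x f) (analysis x r)"
    if "c \<in> ell2" for c
    using that
    by (intro form.representer_exists[OF _ _ ell2_inner_analysis_bounded])
      (simp_all only: ip_add_left ip_scale_left ell2_inner_add_left ell2_inner_scale_left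
        analysis_in_ell2)
  then obtain R where R: "\<And>c f. c \<in> ell2 \<Longrightarrow>
      ell2_inner (analysis x f) c = ell2_inner (analysis x f) (analysis x (R c))"
    by metis
  have R_eq: "R c = r"
    if "c \<in> ell2" "\<And>f. ell2_inner (analysis x f) c = ell2_inner (analysis x f) (analysis x r)"
    for c r
    by (rule form.representer_unique) (metis R that)
  have "R (\<lambda>n. c n + d n) = R c + R d" if "c \<in> ell2" "d \<in> ell2" for c d
    by (rule R_eq[OF ell2_add[OF that]])
      (simp only: ell2_inner_add_right[OF that analysis_in_ell2] form.add_right
        R[OF that(1)] R[OF that(2)])
  moreover have "R (\<lambda>n. a * c n) = smul a (R c)" if "c \<in> ell2" for a c
    by (rule R_eq[OF ell2_scale[OF that]])
      (simp only: ell2_inner_scale_right[OF analysis_in_ell2 that] form.scale_right R[OF that])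
  \<comment> \<open>Testing the defining identity at \<open>f = R c\<close> shows that
    \<open>analysis x (R c)\<close> is no longer than \<open>c\<close>; the lower frame bound then
    gives \<open>1 / sqrt m\<close>.\<close>
  moreover have "norm (R c) \<le> (1 / sqrt m) * ell2_norm c" if "c \<in> ell2" for c
  proof -
    let ?E = "ell2_norm (analysis x (R c))"
    have "?E\<^sup>2 = norm (ell2_inner (analysis x (R c)) c)"
      by (simp add: R[OF that] form.self norm_power abs_of_nonneg analysis_in_ell2)
    also have "\<dots> \<le> ?E * ell2_norm c"
      by (intro norm_ell2_inner_le analysis_in_ell2 that)
    finally have "?E \<le> ell2_norm c"
      using that ell2_norm_nonneg[OF analysis_in_ell2, of "R c"]
      by (cases "?E = 0") (auto simp: power2_eq_square mult_le_cancel_left)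
    moreover have "sqrt m * norm (R c) \<le> ?E"
      using real_sqrt_le_mono[OF lower[of "R c"]] analysis_in_ell2[of "R c"]
      by (simp add: real_sqrt_mult del: real_sqrt_le_iff)
    ultimately show ?thesis using m_pos by (simp add: field_simps)
  qed
  moreover have "R (analysis x f) = f" for f
    by (rule R_eq[OF analysis_in_ell2 refl])
  ultimately show ?thesis unfolding bounded_operator_ell2_def by blast
qed

end

section \<open>Stable recovery as a frame property\<close>

context hilbert_space
begin

text \<open>The upper bound is the Baire argument of \<open>analysis_bounded\<close>; the lower one
  is the bound on \<open>R\<close> evaluated at \<open>analysis x f\<close>.\<close>

lemma frame_of_bounded_left_inverse:
  assumes x: "\<And>f. analysis x f \<in> ell2"
    and R: "bounded_operator_ell2 smul R" "\<And>f. R (analysis x f) = f"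
  obtains m M where "frame smul ip x m M"
proof -
  obtain M where M: "0 \<le> M" "\<And>f. (ell2_norm (analysis x f))\<^sup>2 \<le> M * (norm f)\<^sup>2"
    using analysis_bounded[OF x] by blast
  from R(1) obtain K where "\<And>c. c \<in> ell2 \<Longrightarrow> norm (R c) \<le> K * ell2_norm c"
    unfolding bounded_operator_ell2_def by blast
  from this[OF x] have K: "norm f \<le> K * ell2_norm (analysis x f)" for f
    by (simp add: R(2))
  \<comment> \<open>The maximum with 1 keeps the constant positive, so that its square can be
    inverted.\<close>
  define L where "L = max K 1"
  have "(1 / L\<^sup>2) * (norm f)\<^sup>2 \<le> (ell2_norm (analysis x f))\<^sup>2" for f
  proof -
    have "norm f \<le> L * ell2_norm (analysis x f)"
      using mult_right_mono[of K L "ell2_norm (analysis x f)"] x[of f] K[of f]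
      by (simp add: L_def)
    from power_mono[OF this, of 2] have "(norm f)\<^sup>2 \<le> L\<^sup>2 * (ell2_norm (analysis x f))\<^sup>2"
      by (simp add: power_mult_distrib)
    moreover have "0 < L\<^sup>2" by (simp add: L_def)
    ultimately show ?thesis by (simp add: field_simps)
  qed
  moreover have "0 < 1 / L\<^sup>2" by (simp add: L_def)
  ultimately have "frame smul ip x (1 / L\<^sup>2) M"
    using x M by unfold_locales
  then show thesis by (rule that)
qed

lemma stably_recoverable_iff_frame:
  assumes "bounded_operator smul C"
  shows "stably_recoverable smul ip C u \<longleftrightarrow>
    (\<exists>m M. frame smul ip (\<lambda>n. (hilbert_adjoint ip C ^^ n) u) m M)"
    (is "_ \<longleftrightarrow> (\<exists>m M. frame smul ip ?x m M)")
proof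
  assume "stably_recoverable smul ip C u"
  then show "\<exists>m M. frame smul ip ?x m M"
    unfolding stably_recoverable_def bounded_operator_adjoint_funpow[OF assms]
    using frame_of_bounded_left_inverse[of ?x] by blast
next
  assume "\<exists>m M. frame smul ip ?x m M"
  then obtain m M where "frame smul ip ?x m M" by blast
  then interpret frame smul ip ?x m M .
  show "stably_recoverable smul ip C u"
    unfolding stably_recoverable_def bounded_operator_adjoint_funpow[OF assms]
    using analysis_in_ell2 bounded_left_inverse by blast
qed

end

subsection \<open>Perturbation\<close>

text \<open>A sum of squares is at most the square of the sum, so \<open>norm (v - w)\<close> is at
  most \<open>sqrt \<mu>\<close> times \<open>norm v + norm w\<close>; as
  \<open>sqrt \<mu> < 1\<close>, the part with \<open>norm w\<close> is absorbed on the
  left.\<close>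

lemma norm_le_of_square_perturbation:
  fixes v w :: "'a::real_normed_vector"
  assumes "0 \<le> \<mu>" "\<mu> < 1"
    and "(norm (v - w))\<^sup>2 \<le> \<mu> * ((norm v)\<^sup>2 + (norm w)\<^sup>2)"
  shows "norm w \<le> (1 + sqrt \<mu>) / (1 - sqrt \<mu>) * norm v"
proof -
  have "(norm (v - w))\<^sup>2 \<le> \<mu> * (norm v + norm w)\<^sup>2"
    by (rule order.trans[OF assms(3)], rule mult_left_mono) (auto simp: power2_sum assms)
  from real_sqrt_le_mono[OF this] have "norm (v - w) \<le> sqrt \<mu> * (norm v + norm w)"
    by (simp add: real_sqrt_mult)
  moreover have "norm w \<le> norm v + norm (v - w)"
    using norm_triangle_ineq4[of v "v - w"] by simp
  moreover have "sqrt \<mu> < 1" using assms by simp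
  ultimately show ?thesis by (simp add: field_simps)
qed

context frame
begin

text \<open>The coefficients are the canonical dual ones: \<open>r\<close> is the inverse frame
  operator applied to \<open>f\<close>, and \<open>c = analysis x r\<close>. Their bound comes from
  \<open>(ell2_norm c)\<^sup>2 = norm (ip r f)\<close>.\<close>

lemma expansion:
  obtains c where "c \<in> ell2" "ell2_norm c \<le> norm f / sqrt m"
    "(\<lambda>N. \<Sum>n<N. smul (c n) (x n)) \<longlonglongrightarrow> f"
proof -
  have "\<exists>r. \<forall>w. ip w f = ell2_inner (analysis x w) (analysis x r)"
    by (rule form.representer_exists[where K = "norm f"])
      (use norm_ip_le in \<open>auto simp: ip_add_left ip_scale_left mult.commute\<close>)
  then obtain r where r: "\<And>w. ip w f = ell2_inner (analysis x w) (analysis x r)" by blast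
  define c where "c = analysis x r"
  have c: "c \<in> ell2" unfolding c_def by (rule analysis_in_ell2)
  have bound: "ell2_norm c \<le> norm f / sqrt m"
  proof (cases "ell2_norm c = 0")
    case True
    then show ?thesis using m_pos by simp
  next
    case False
    then have pos: "0 < ell2_norm c" using ell2_norm_nonneg[OF c] by linarith
    have "sqrt m * norm r \<le> ell2_norm c"
      using real_sqrt_le_mono[OF lower[of r]] ell2_norm_nonneg[OF c]
      by (simp add: real_sqrt_mult c_def del: real_sqrt_le_iff)
    then have nr: "norm r \<le> ell2_norm c / sqrt m" using m_pos by (simp add: field_simps)
    have "(ell2_norm c)\<^sup>2 = norm (ip r f)"
      by (simp add: r ell2_inner_self[OF analysis_in_ell2] norm_power c_def)
    also have "\<dots> \<le> ell2_norm c / sqrt m * norm f"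
      using norm_ip_le[of r f] mult_right_mono[OF nr norm_ge_zero[of f]] by linarith
    finally have "ell2_norm c * ell2_norm c \<le> ell2_norm c * (norm f / sqrt m)"
      by (simp add: power2_eq_square)
    then show ?thesis using pos by (simp only: mult_le_cancel_left_pos)
  qed
  define F where "F N = (\<Sum>n<N. smul (c n) (x n))" for N
  define \<tau> where "\<tau> N = ell2_norm (\<lambda>n. c (n + N))" for N
  have shift: "(\<lambda>n. d (n + N)) \<in> ell2" if "d \<in> ell2" for d :: "nat \<Rightarrow> 's" and N
    using that unfolding ell2_def by (auto dest: summable_ignore_initial_segment[where k = N])
  have tail: "\<tau> \<longlonglongrightarrow> 0"
  proof -
    have s: "summable (\<lambda>n. (norm (c n))\<^sup>2)" using c by (simp add: ell2_def)
    have "\<tau> = (\<lambda>N. sqrt ((\<Sum>n. (norm (c n))\<^sup>2) - (\<Sum>n<N. (norm (c n))\<^sup>2)))"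
      unfolding \<tau>_def ell2_norm_def suminf_minus_initial_segment[OF s] ..
    also have "\<dots> \<longlonglongrightarrow> sqrt ((\<Sum>n. (norm (c n))\<^sup>2) - (\<Sum>n. (norm (c n))\<^sup>2))"
      by (intro tendsto_intros summable_LIMSEQ s)
    finally show ?thesis by simp
  qed
  \<comment> \<open>Pairing the remainder \<open>w\<close> with itself leaves only the tail of the
    coefficient series; Cauchy-Schwarz and the upper frame bound then allow one factor
    \<open>norm w\<close> to be cancelled.\<close>
  have error: "norm (f - F N) \<le> sqrt M * \<tau> N" for N
  proof -
    define w where "w = f - F N"
    have sum_w: "summable (\<lambda>n. ip w (x n) * conjugate (c n))"
      by (intro summable_ell2_inner c analysis_in_ell2)
    have "ip w w = ell2_inner (analysis x w) c - (\<Sum>n<N. ip w (x n) * conjugate (c n))"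
      by (subst (2) w_def)
        (simp add: ip.diff_right r F_def ip.sum_right ip.scale_right c_def mult.commute)
    also have "\<dots> = ell2_inner (\<lambda>n. ip w (x (n + N))) (\<lambda>n. c (n + N))"
      unfolding ell2_inner_def suminf_minus_initial_segment[OF sum_w] ..
    finally have "(norm w)\<^sup>2 = norm (ell2_inner (\<lambda>n. ip w (x (n + N))) (\<lambda>n. c (n + N)))"
      by (metis ip_self norm_of_real abs_power2)
    also have "\<dots> \<le> ell2_norm (\<lambda>n. ip w (x (n + N))) * \<tau> N"
      unfolding \<tau>_def by (intro norm_ell2_inner_le shift c shift[OF analysis_in_ell2])
    also have "ell2_norm (\<lambda>n. ip w (x (n + N))) \<le> ell2_norm (analysis x w)"
    proof -
      have s: "summable (\<lambda>n. (norm (ip w (x n)))\<^sup>2)"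
        using analysis_in_ell2[of w] by (simp add: ell2_def)
      show ?thesis
        unfolding ell2_norm_def suminf_minus_initial_segment[OF s]
        by (simp add: sum_nonneg)
    qed
    also have "\<dots> \<le> sqrt M * norm w" by (rule upper_sqrt)
    finally have "norm w * norm w \<le> norm w * (sqrt M * \<tau> N)"
      using ell2_norm_nonneg[OF shift[OF c]] by (simp add: power2_eq_square mult_ac \<tau>_def mult_right_mono)
    moreover have "0 \<le> sqrt M * \<tau> N"
      using ell2_norm_nonneg[OF shift[OF c]] M_nonneg by (simp add: \<tau>_def)
    ultimately show ?thesis
      by (cases "norm w = 0") (auto simp: mult_le_cancel_left w_def)
  qed
  have "(\<lambda>N. f - F N) \<longlonglongrightarrow> 0"
    by (rule Lim_null_comparison[OF _ tendsto_mult_right_zero[OF tail, of "sqrt M"]])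
      (intro always_eventually allI error)
  then have "F \<longlonglongrightarrow> f" using LIM_zero_cancel[of "\<lambda>N. - F N" "- f"]
    by (simp add: tendsto_minus_cancel_left)
  then have "(\<lambda>N. \<Sum>n<N. smul (c n) (x n)) \<longlonglongrightarrow> f" unfolding F_def .
  with c bound show thesis by (rule that)
qed

text \<open>The upper constant is \<open>M\<close> times the square of the factor comparing
  combinations of \<open>y\<close> with those of \<open>x\<close>. The lower one is the square of
  \<open>(1 - \<mu>) * norm f \<le> 2 * T / sqrt m\<close>, where \<open>T\<close> is the norm of
  \<open>analysis y f\<close>.\<close>

lemma frame_perturbation:
  assumes lam: "0 \<le> \<mu>" "\<mu> < 1"
    and pert: "\<And>N a. (norm (\<Sum>n<N. smul (a n) (x n - y n)))\<^sup>2
      \<le> \<mu> * ((norm (\<Sum>n<N. smul (a n) (x n)))\<^sup>2 + (norm (\<Sum>n<N. smul (a n) (y n)))\<^sup>2)"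
  shows "frame smul ip y (m * (1 - \<mu>)\<^sup>2 / 4) (((1 + sqrt \<mu>) / (1 - sqrt \<mu>))\<^sup>2 * M)"
proof -
  define C where "C = (1 + sqrt \<mu>) / (1 - sqrt \<mu>)"
  have C: "0 \<le> C" using lam by (simp add: C_def)
  have pert': "(norm ((\<Sum>n<N. smul (a n) (x n)) - (\<Sum>n<N. smul (a n) (y n))))\<^sup>2
      \<le> \<mu> * ((norm (\<Sum>n<N. smul (a n) (x n)))\<^sup>2 + (norm (\<Sum>n<N. smul (a n) (y n)))\<^sup>2)" for N a
    using pert[where N = N and a = a] by (simp add: scale_right_diff_distrib sum_subtractf)
  have y_le: "norm (\<Sum>n<N. smul (a n) (y n)) \<le> C * norm (\<Sum>n<N. smul (a n) (x n))" for N a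
    unfolding C_def by (rule norm_le_of_square_perturbation[OF lam pert'])
  have partial: "(\<Sum>n<N. (norm (ip f (y n)))\<^sup>2) \<le> C\<^sup>2 * M * (norm f)\<^sup>2" for f N
  proof -
    define L where "L = L2_set (\<lambda>n. norm (ip f (y n))) {..<N}"
    have L: "0 \<le> L" "L\<^sup>2 = (\<Sum>n<N. (norm (ip f (y n)))\<^sup>2)"
      by (simp_all add: L_def L2_set_def sum_nonneg)
    \<comment> \<open>Duality: with the coefficients \<open>ip f (y n)\<close> the pairing
      \<open>ip f w\<close> equals the square of \<open>L\<close>, while \<open>norm w\<close> is at
      most \<open>C * sqrt M * L\<close>; one factor \<open>L\<close> cancels.\<close>
    define w where "w = (\<Sum>n<N. smul (ip f (y n)) (y n))"
    have "ip f w = (\<Sum>n<N. of_real ((norm (ip f (y n)))\<^sup>2))"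
      unfolding w_def ip.sum_right ip.scale_right mult_conjugate_of_real[symmetric]
      by (simp add: mult.commute)
    then have "L\<^sup>2 = norm (ip f w)"
      by (simp add: L norm_of_real abs_of_nonneg sum_nonneg flip: of_real_sum of_real_power)
    also have "\<dots> \<le> norm f * norm w" by (rule norm_ip_le)
    also have "\<dots> \<le> norm f * (C * (sqrt M * L))"
      using y_le[where N = N and a = "\<lambda>n. ip f (y n)"]
        norm_synthesis_le[of "{..<N}" "\<lambda>n. ip f (y n)"] C
      by (intro mult_left_mono) (auto simp: w_def L_def intro: order.trans mult_left_mono)
    finally have "L * L \<le> L * (C * sqrt M * norm f)" by (simp add: power2_eq_square mult_ac)
    moreover have "0 \<le> C * sqrt M * norm f" using C M_nonneg by simp
    ultimately have "L \<le> C * sqrt M * norm f"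
      using L(1) by (cases "L = 0") (auto simp: mult_le_cancel_left)
    from power_mono[OF this L(1), of 2] show ?thesis
      using M_nonneg by (simp add: L power_mult_distrib)
  qed
  have y_ell2: "analysis y f \<in> ell2" for f
    unfolding ell2_def by (simp, rule summableI_nonneg_bounded[OF _ partial]) simp
  have y_upper: "(ell2_norm (analysis y f))\<^sup>2 \<le> C\<^sup>2 * M * (norm f)\<^sup>2" for f
    unfolding ell2_norm_square[OF y_ell2]
    by (rule suminf_le_const[OF _ partial]) (use y_ell2 in \<open>simp add: ell2_def\<close>)
  have y_lower: "m * (1 - \<mu>)\<^sup>2 / 4 * (norm f)\<^sup>2 \<le> (ell2_norm (analysis y f))\<^sup>2" for f
  proof -
    obtain c where c: "c \<in> ell2" "ell2_norm c \<le> norm f / sqrt m"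
      and lim: "(\<lambda>N. \<Sum>n<N. smul (c n) (x n)) \<longlonglongrightarrow> f" by (rule expansion)
    define T where "T = ell2_norm (analysis y f)"
    have T: "0 \<le> T" unfolding T_def by (rule ell2_norm_nonneg[OF y_ell2])
    define v where "v N = (\<Sum>n<N. smul (c n) (x n))" for N
    define w where "w N = (\<Sum>n<N. smul (c n) (y n))" for N
    have v: "v \<longlonglongrightarrow> f" using lim unfolding v_def .
    have fw: "norm (ip f (w N)) \<le> ell2_norm c * T" for N
    proof -
      have "norm (ip f (w N)) \<le> (\<Sum>n<N. norm (c n) * norm (ip f (y n)))"
        unfolding w_def ip.sum_right ip.scale_right
        by (rule order.trans[OF norm_sum]) (simp add: norm_mult)
      also have "\<dots> \<le> (\<Sum>n. norm (c n) * norm (ip f (y n)))"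
        by (rule sum_le_suminf[OF summable_norm_mult_ell2[OF c(1) y_ell2]]) auto
      also have "\<dots> \<le> ell2_norm c * T"
        unfolding T_def by (rule suminf_norm_mult_ell2[OF c(1) y_ell2])
      finally show ?thesis .
    qed
    \<comment> \<open>\<open>ip (v N) (w N) + ip (w N) (v N)\<close> is the real quantity obtained
      by expanding the squared norm of \<open>v N - w N\<close>, and the perturbation bound keeps it
      above \<open>1 - \<mu>\<close> times the sum of squares.\<close>
    have coercive: "(1 - \<mu>) * (norm (v N))\<^sup>2 \<le> 2 * norm (ip (v N) (w N))" for N
    proof -
      have "(norm (v N))\<^sup>2 + (norm (w N))\<^sup>2 - (norm (v N - w N))\<^sup>2
          \<le> norm (of_real ((norm (v N))\<^sup>2 + (norm (w N))\<^sup>2 - (norm (v N - w N))\<^sup>2) :: 's)"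
        by (simp only: norm_of_real abs_ge_self)
      also have "\<dots> = norm (ip (v N) (w N) + ip (w N) (v N))"
        using ip.diff_self[of "v N" "w N"] by simp
      also have "\<dots> \<le> 2 * norm (ip (v N) (w N))"
        using norm_triangle_ineq[of "ip (v N) (w N)" "ip (w N) (v N)"]
        by (simp add: ip.norm_commute[of "w N"])
      finally have "(1 - \<mu>) * ((norm (v N))\<^sup>2 + (norm (w N))\<^sup>2) \<le> 2 * norm (ip (v N) (w N))"
        using pert'[where N = N and a = c] by (simp add: v_def w_def algebra_simps)
      moreover have "(1 - \<mu>) * (norm (v N))\<^sup>2 \<le> (1 - \<mu>) * ((norm (v N))\<^sup>2 + (norm (w N))\<^sup>2)"
        using lam by (intro mult_left_mono) auto
      ultimately show ?thesis by linarith
    qed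
    \<comment> \<open>Replacing \<open>v N\<close> by \<open>f\<close> in the first slot costs
      \<open>norm (v N - f) * norm (w N)\<close>. Since \<open>norm (w N)\<close> is at most
      \<open>C * norm (v N)\<close>, this error vanishes in the limit.\<close>
    have step: "(1 - \<mu>) * (norm (v N))\<^sup>2
        \<le> 2 * (ell2_norm c * T + norm (v N - f) * (C * norm (v N)))" for N
    proof -
      have "norm (ip (v N) (w N)) \<le> norm (ip f (w N)) + norm (ip (v N - f) (w N))"
        using norm_triangle_ineq[of "ip f (w N)" "ip (v N - f) (w N)"] by (simp add: ip.diff_left)
      moreover have "norm (ip (v N - f) (w N)) \<le> norm (v N - f) * (C * norm (v N))"
        by (rule order.trans[OF norm_ip_le]) (simp add: v_def w_def y_le mult_left_mono)
      ultimately have "norm (ip (v N) (w N)) \<le> ell2_norm c * T + norm (v N - f) * (C * norm (v N))"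
        using fw[of N] by linarith
      then show ?thesis by (intro order.trans[OF coercive] mult_left_mono) auto
    qed
    \<comment> \<open>The zero term with \<open>f - f\<close> is kept so that the right side is
      literally the limit of the bound in \<open>step\<close>.\<close>
    have "(1 - \<mu>) * (norm f)\<^sup>2 \<le> 2 * (ell2_norm c * T + norm (f - f) * (C * norm f))"
    proof (rule LIMSEQ_le)
      show "(\<lambda>N. (1 - \<mu>) * (norm (v N))\<^sup>2) \<longlonglongrightarrow> (1 - \<mu>) * (norm f)\<^sup>2"
        by (intro tendsto_intros v)
      show "(\<lambda>N. 2 * (ell2_norm c * T + norm (v N - f) * (C * norm (v N))))
          \<longlonglongrightarrow> 2 * (ell2_norm c * T + norm (f - f) * (C * norm f))"
        by (intro tendsto_intros v)
    qed (use step in blast)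
    also have "\<dots> \<le> 2 * ((norm f / sqrt m) * T)" using mult_right_mono[OF c(2) T] by simp
    finally have *: "norm f * ((1 - \<mu>) * norm f) \<le> norm f * (2 * T / sqrt m)"
      by (simp add: power2_eq_square mult_ac)
    have "(1 - \<mu>) * norm f \<le> 2 * T / sqrt m"
    proof (cases "f = 0")
      case False
      then have "0 < norm f" by simp
      with * show ?thesis by (simp only: mult_le_cancel_left_pos)
    qed (use T m_pos in simp)
    then have "sqrt m * ((1 - \<mu>) * norm f) / 2 \<le> T" using m_pos by (simp add: field_simps)
    from power_mono[OF this, of 2] lam m_pos show ?thesis
      by (simp add: power_mult_distrib power_divide T_def mult_ac)
  qed
  have "frame smul ip y (m * (1 - \<mu>)\<^sup>2 / 4) (C\<^sup>2 * M)"
    using y_ell2 y_upper y_lower m_pos M_nonneg lam by unfold_locales auto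
  then show ?thesis by (simp add: C_def)
qed

end

section \<open>Reduction of the operator hypothesis to a frame perturbation\<close>

theorem theorem4p5:
  fixes smul :: "'s::real_or_complex_field \<Rightarrow> 'a::banach \<Rightarrow> 'a"
    and ip :: "'a \<Rightarrow> 'a \<Rightarrow> 's"
    and g h :: 'a
    and A B :: "'a \<Rightarrow> 'a"
  assumes "hilbert_space smul ip"
    and "separable_space (euclidean :: 'a topology)"
    and "bounded_operator smul A"
    and "bounded_operator smul B"
    and "stably_recoverable smul ip A g"
    and "\<And>k::real. k > 0 \<Longrightarrow>
      \<exists>lam1 lam2 :: real. lam1 \<ge> 0 \<and> lam2 \<ge> 0 \<and> max lam1 lam2 < min 1 (2 powr (k - 1)) \<and>
        (\<forall>(l::nat) (a :: nat \<Rightarrow> 's).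
          norm (\<Sum>n=0..l. smul (a n) ((hilbert_adjoint ip A ^^ n) (g - h)))
          + norm (\<Sum>n=0..l. smul (a n)
              ((hilbert_adjoint ip A ^^ n) h - (hilbert_adjoint ip B ^^ n) h))
          \<le> (lam1 * norm (\<Sum>n=0..l. smul (a n) ((hilbert_adjoint ip A ^^ n) g)) powr k
              + lam2 * norm (\<Sum>n=0..l. smul (a n) ((hilbert_adjoint ip B ^^ n) h)) powr k)
            powr (1 / k))"
  shows "stably_recoverable smul ip B h"
proof -
  interpret hilbert_space smul ip by fact
  define x where "x = (\<lambda>n. (hilbert_adjoint ip A ^^ n) g)"
  define y where "y = (\<lambda>n. (hilbert_adjoint ip B ^^ n) h)"
  obtain m M where frame: "frame smul ip x m M"
    using assms(3,5) by (auto simp: stably_recoverable_iff_frame x_def)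
  \<comment> \<open>At \<open>k = 2\<close> the threshold \<open>min 1 (2 powr (k - 1))\<close> is 1
    and the outer power is a square root.\<close>
  obtain lam1 lam2 where lam: "0 \<le> lam1" "0 \<le> lam2" "max lam1 lam2 < min 1 (2 powr (2 - 1))"
    and ineq: "\<And>l a. norm (\<Sum>n=0..l. smul (a n) ((hilbert_adjoint ip A ^^ n) (g - h)))
          + norm (\<Sum>n=0..l. smul (a n) ((hilbert_adjoint ip A ^^ n) h - y n))
          \<le> (lam1 * norm (\<Sum>n=0..l. smul (a n) (x n)) powr 2
              + lam2 * norm (\<Sum>n=0..l. smul (a n) (y n)) powr 2) powr (1 / 2)"
    using assms(6)[of 2] unfolding x_def y_def by auto
  define \<mu> where "\<mu> = max lam1 lam2"
  have \<mu>: "0 \<le> \<mu>" "\<mu> < 1" using lam by (auto simp: \<mu>_def)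
  have pert: "(norm (\<Sum>n<N. smul (a n) (x n - y n)))\<^sup>2
      \<le> \<mu> * ((norm (\<Sum>n<N. smul (a n) (x n)))\<^sup>2 + (norm (\<Sum>n<N. smul (a n) (y n)))\<^sup>2)" for N a
  \<comment> \<open>The hypothesis sums over \<open>0..l\<close>, so \<open>N = Suc l\<close>
    matches it; for \<open>N = 0\<close> all sums are empty.\<close>
  proof (cases N)
    case (Suc l)
    have set: "{..<N} = {0..l}" using Suc by auto
    define X where "X = norm (\<Sum>n<N. smul (a n) (x n))"
    define Y where "Y = norm (\<Sum>n<N. smul (a n) (y n))"
    \<comment> \<open>Inserting the iterates of the adjoint of \<open>A\<close> at \<open>h\<close>
      splits \<open>x n - y n\<close> into the two differences in the hypothesis; the triangle
      inequality then applies.\<close>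
    have "(\<Sum>n<N. smul (a n) (x n - y n))
        = (\<Sum>n<N. smul (a n) ((hilbert_adjoint ip A ^^ n) (g - h)))
          + (\<Sum>n<N. smul (a n) ((hilbert_adjoint ip A ^^ n) h - y n))"
      unfolding x_def adjoint_funpow_diff[OF assms(3)] sum.distrib[symmetric]
        scale_right_distrib[symmetric]
      by simp
    then have "norm (\<Sum>n<N. smul (a n) (x n - y n))
        \<le> (lam1 * X powr 2 + lam2 * Y powr 2) powr (1 / 2)"
      using ineq[of a l] unfolding X_def Y_def set
      by (simp only: order.trans[OF norm_triangle_ineq])
    also have "\<dots> = sqrt (lam1 * X\<^sup>2 + lam2 * Y\<^sup>2)"
      using lam by (simp add: X_def Y_def powr_half_sqrt)
    finally have "(norm (\<Sum>n<N. smul (a n) (x n - y n)))\<^sup>2 \<le> (sqrt (lam1 * X\<^sup>2 + lam2 * Y\<^sup>2))\<^sup>2"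
      by (rule power_mono) simp
    also have "\<dots> = lam1 * X\<^sup>2 + lam2 * Y\<^sup>2" using lam by simp
    also have "\<dots> \<le> \<mu> * X\<^sup>2 + \<mu> * Y\<^sup>2"
      by (intro add_mono mult_right_mono) (auto simp: \<mu>_def)
    finally show ?thesis by (simp add: X_def Y_def distrib_left)
  qed simp
  have "\<exists>m M. frame smul ip y m M"
    using frame.frame_perturbation[OF frame \<mu> pert] by blast
  then show ?thesis using assms(4) by (simp add: stably_recoverable_iff_frame y_def)
qed

end
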